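(* Let $\mu\in\{0,\dots,T-1\}$. Adaptive multistage stochastic programming can be correctly formulated as the following problem $(AMS_\mu+)$: $$\min_{\mathbf{x},\mathbf{y},\mathbf{r}}\ \sum_{n\in\mathcal{T}}p_n\left(\mathbf{a}_n^\top\mathbf{x}_n+\mathbf{b}_n^\top\mathbf{y}_n\right)$$ subject to (A), (B), (D) and $$x_{in}\ \ge\ x_{in^{+}}-\bar{x}_i\left(r_{it}-r_{it_{a(n,n^{+})}}\right)\qquad\text{for all } t\in\mathcal{P},\ i\in\mathcal{I}\text{ and all reduced pairs }(n,n^{+})\text{ of } S_t\text{ with } t_{a(n,n^{+})}\in\mathcal{P}_t ,$$ where $t_{a(n,n^+)}$ is the stage of the last common ancestor of $n$ and $n^+$ and $\mathcal{P}_t=\{(t-(T-\mu)+1)^{+},\dots,t-1\}$. Moreover, $(AMS_\mu+)$ is equivalent to $(AMS_\mu)$.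
   Context: A scenario tree $\mathcal{T}$ has $T$ stages, $\mathcal{P}=\{1,\dots,T\}$; every non-leaf node has $B$ children. $S_t$ is the set of nodes of stage $t$, $P(n)$ is the set of nodes on the path from the root to $n$ (inclusive), and $\mathcal{T}(l)$ is the subtree rooted at node $l$. The last common ancestor of two nodes $m,n$ is the node of largest stage in $P(m)\cap P(n)$. Node $n$ has probability $p_n$. At each node $n$ there are state variables $\mathbf{x}_n=(x_{1n},\dots,x_{In})$ and stage variables $\mathbf{y}_n$ (integer or continuous); $\mathcal{I}=\{1,\dots,I\}$. Data: $\mathbf{a}_n,\mathbf{b}_n,\mathbf{C}_{nm},\mathbf{D}_n,\mathbf{d}_n$ and local sets $\mathcal{X}_n,\mathcal{Y}_n$. State variables satisfy $0\le x_{in}\le\bar{x}_i$, where $\bar{x}_i$ is a given upper bound; these bounds are implied by $\mathbf{x}_n\in\mathcal{X}_n$. $(AMS_\mu)$, for $\mu\in\{0,\dots,T-1\}$, is the formulation of adaptive multistage stochastic programming with at most $\mu$ revisions: minimize $\sum_{n\in\mathcal{T}}p_n(\mathbf{a}_n^\top\mathbf{x}_n+\mathbf{b}_n^\top\mathbf{y}_n)$ over $(\mathbf{x},\mathbf{y},\mathbf{r})$ subject to (A) $\sum_{m\in P(n)}\mathbf{C}_{nm}\mathbf{x}_m+\mathbf{D}_n\mathbf{y}_n\ge\mathbf{d}_n$ for all $n\in\mathcal{T}$; (B) $\mathbf{x}_n\in\mathcal{X}_n,\ \mathbf{y}_n\in\mathcal{Y}_n$ for all $n\in\mathcal{T}$;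 (C) (non-anticipativity constraints) $x_{im}\ge x_{in}-\bar{x}_i(r_{it'}-r_{it})$ and $x_{im}\le x_{in}+\bar{x}_i(r_{it'}-r_{it})$ for all $m,n\in S_{t'}\cap\mathcal{T}(l)$, $l\in S_t$, $t'\ge t$, $t,t'\in\mathcal{P}$, $i\in\mathcal{I}$; (D) $r_{i1}\le r_{i2}\le\dots\le r_{iT}\le\mu$; $r_{i(t+1)}-r_{it}\le1$ for $t\in\{1,\dots,T-1\}$; $r_{i1}=0$; $r_{it}\in\mathbb{Z}_{+}$, for all $i\in\mathcal{I}$, $t\in\mathcal{P}$. Ordering and reduced pairs: the nodes of each $S_t$ are ordered left to right, consistently with the tree (fix an order of the children of every node; the nodes of $S_t$ are listed in the resulting depth-first order), so that for each node $l$ of stage at most $t$ the set $S_t\cap\mathcal{T}(l)$ is a block of consecutive nodes. A reduced pair of $S_t$ is a pair $(n,n^{+})$ of distinct nodes of $S_t$ such that, with $l$ the last common ancestor of $n$ and $n^{+}$, the node $n^{+}$ is the cyclic successor of $n$ in the ordered set $S_t\cap\mathcal{T}(l)$ (the successor of the last node being the first node). Here $(a)^+=\max(a,0)$, and $\mathcal{P}_t$ is empty if its lower end exceeds its upper end. Two formulations with this same objective are called equivalent if the same pairs $(\mathbf{x},\mathbf{y})$ are feasible for both, each together with some $\mathbf{r}$ (possibly different); hence they have the same optimal value. *)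

theory Defs
  imports "HOL-Analysis.Analysis"
begin

record 'v tree =
  nodes :: "'v set"
  root :: 'v
  parent :: "'v \<Rightarrow> 'v"
  stage :: "'v \<Rightarrow> nat"
  child :: "'v \<Rightarrow> nat \<Rightarrow> 'v"
  horizon :: nat
  branching :: nat

text \<open>The enumeration \<open>child n 0, \<dots>, child n (B - 1)\<close> is the fixed left-to-right order of the
  children of the non-leaf node \<open>n\<close>.\<close>

locale scenario_tree =
  fixes Tr :: "'v tree"
  assumes horizon_pos: "1 \<le> horizon Tr"
    and branching_pos: "1 \<le> branching Tr"
    and root_node: "root Tr \<in> nodes Tr"
    and stage_root: "stage Tr (root Tr) = 1"
    and parent_node: "\<And>n. n \<in> nodes Tr \<Longrightarrow> n \<noteq> root Tr \<Longrightarrow> parent Tr n \<in> nodes Tr"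
    and stage_parent: "\<And>n. n \<in> nodes Tr \<Longrightarrow> n \<noteq> root Tr \<Longrightarrow>
          stage Tr n = Suc (stage Tr (parent Tr n))"
    and stage_le: "\<And>n. n \<in> nodes Tr \<Longrightarrow> stage Tr n \<le> horizon Tr"
    and children: "\<And>n. n \<in> nodes Tr \<Longrightarrow> stage Tr n < horizon Tr \<Longrightarrow>
          bij_betw (child Tr n) {..<branching Tr}
            {m \<in> nodes Tr. m \<noteq> root Tr \<and> parent Tr m = n}"

definition stages :: "'v tree \<Rightarrow> nat set" where
  "stages Tr = {1..horizon Tr}"

definition stage_nodes :: "'v tree \<Rightarrow> nat \<Rightarrow> 'v set" where
  "stage_nodes Tr t = {n \<in> nodes Tr. stage Tr n = t}"

text \<open>A node of stage \<open>s\<close> has exactly \<open>s\<close> nodes on its path from the root.\<close>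

definition path_to :: "'v tree \<Rightarrow> 'v \<Rightarrow> 'v set" where
  "path_to Tr n = {(parent Tr ^^ k) n | k. k < stage Tr n}"

definition subtree :: "'v tree \<Rightarrow> 'v \<Rightarrow> 'v set" where
  "subtree Tr l = {n \<in> nodes Tr. l \<in> path_to Tr n}"

definition last_common_ancestor :: "'v tree \<Rightarrow> 'v \<Rightarrow> 'v \<Rightarrow> 'v" where
  "last_common_ancestor Tr m n = arg_max (stage Tr) (\<lambda>k. k \<in> path_to Tr m \<inter> path_to Tr n)"

text \<open>Depth-first (preorder) listing of the descendants of \<open>n\<close> down to \<open>h\<close> levels below \<open>n\<close>.\<close>

primrec dfs :: "'v tree \<Rightarrow> nat \<Rightarrow> 'v \<Rightarrow> 'v list" where
  "dfs Tr 0 n = [n]"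
| "dfs Tr (Suc h) n = n # concat (map (\<lambda>j. dfs Tr h (child Tr n j)) [0..<branching Tr])"

definition stage_list :: "'v tree \<Rightarrow> nat \<Rightarrow> 'v list" where
  "stage_list Tr t = filter (\<lambda>n. stage Tr n = t) (dfs Tr (horizon Tr - 1) (root Tr))"

definition block :: "'v tree \<Rightarrow> nat \<Rightarrow> 'v \<Rightarrow> 'v list" where
  "block Tr t l = filter (\<lambda>n. n \<in> subtree Tr l) (stage_list Tr t)"

definition cyclic_successor :: "'v list \<Rightarrow> 'v \<Rightarrow> 'v \<Rightarrow> bool" where
  "cyclic_successor ns n n' \<longleftrightarrow>
     (\<exists>k < length ns. ns ! k = n \<and> ns ! (Suc k mod length ns) = n')"

definition reduced_pair :: "'v tree \<Rightarrow> nat \<Rightarrow> 'v \<Rightarrow> 'v \<Rightarrow> bool" where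
  "reduced_pair Tr t n n' \<longleftrightarrow>
     n \<in> stage_nodes Tr t \<and> n' \<in> stage_nodes Tr t \<and> n \<noteq> n' \<and>
     cyclic_successor (block Tr t (last_common_ancestor Tr n n')) n n'"

text \<open>The index types \<open>'i\<close>, \<open>'j\<close> and \<open>'k\<close> index the state variables, the stage variables and the
  rows of the linear constraints at a node. Integrality requirements on \<open>x\<close> and \<open>y\<close> are part of
  the arbitrary sets \<open>X_set n\<close> and \<open>Y_set n\<close>.\<close>

record ('v, 'i, 'j, 'k) msp_data =
  prob :: "'v \<Rightarrow> real"
  cost_x :: "'v \<Rightarrow> real ^ 'i::finite"
  cost_y :: "'v \<Rightarrow> real ^ 'j::finite"
  coef_x :: "'v \<Rightarrow> 'v \<Rightarrow> real ^ 'i ^ 'k::finite"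
  coef_y :: "'v \<Rightarrow> real ^ 'j ^ 'k"
  rhs :: "'v \<Rightarrow> real ^ 'k"
  X_set :: "'v \<Rightarrow> (real ^ 'i) set"
  Y_set :: "'v \<Rightarrow> (real ^ 'j) set"
  x_ub :: "real ^ 'i"

locale adaptive_msp = scenario_tree Tr
  for Tr :: "'v tree" +
  fixes Dt :: "('v, 'i::finite, 'j::finite, 'k::finite) msp_data"
  assumes prob_nonneg: "\<And>n. n \<in> nodes Tr \<Longrightarrow> 0 \<le> prob Dt n"
    and prob_root: "prob Dt (root Tr) = 1"
    and prob_children: "\<And>n. n \<in> nodes Tr \<Longrightarrow> stage Tr n < horizon Tr \<Longrightarrow>
          (\<Sum>k<branching Tr. prob Dt (child Tr n k)) = prob Dt n"
    and state_bounds: "\<And>n \<xi> i. n \<in> nodes Tr \<Longrightarrow> \<xi> \<in> X_set Dt n \<Longrightarrow>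
          0 \<le> \<xi> $ i \<and> \<xi> $ i \<le> x_ub Dt $ i"

definition objective ::
  "'v tree \<Rightarrow> ('v, 'i::finite, 'j::finite, 'k::finite) msp_data \<Rightarrow>
     ('v \<Rightarrow> real ^ 'i) \<Rightarrow> ('v \<Rightarrow> real ^ 'j) \<Rightarrow> real" where
  "objective Tr Dt x y =
     (\<Sum>n\<in>nodes Tr. prob Dt n * (cost_x Dt n \<bullet> x n + cost_y Dt n \<bullet> y n))"

definition linear_constraints ::
  "'v tree \<Rightarrow> ('v, 'i::finite, 'j::finite, 'k::finite) msp_data \<Rightarrow>
     ('v \<Rightarrow> real ^ 'i) \<Rightarrow> ('v \<Rightarrow> real ^ 'j) \<Rightarrow> bool" where
  "linear_constraints Tr Dt x y \<longleftrightarrow>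
     (\<forall>n\<in>nodes Tr. \<forall>k.
        ((\<Sum>m\<in>path_to Tr n. coef_x Dt n m *v x m) + coef_y Dt n *v y n) $ k \<ge> rhs Dt n $ k)"

definition local_constraints ::
  "'v tree \<Rightarrow> ('v, 'i::finite, 'j::finite, 'k::finite) msp_data \<Rightarrow>
     ('v \<Rightarrow> real ^ 'i) \<Rightarrow> ('v \<Rightarrow> real ^ 'j) \<Rightarrow> bool" where
  "local_constraints Tr Dt x y \<longleftrightarrow>
     (\<forall>n\<in>nodes Tr. x n \<in> X_set Dt n \<and> y n \<in> Y_set Dt n)"

definition nonanticipativity ::
  "'v tree \<Rightarrow> ('v, 'i::finite, 'j::finite, 'k::finite) msp_data \<Rightarrow>
     ('v \<Rightarrow> real ^ 'i) \<Rightarrow> ('i \<Rightarrow> nat \<Rightarrow> int) \<Rightarrow> bool" where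
  "nonanticipativity Tr Dt x r \<longleftrightarrow>
     (\<forall>t\<in>stages Tr. \<forall>t'\<in>stages Tr. t' \<ge> t \<longrightarrow>
       (\<forall>l\<in>stage_nodes Tr t.
        \<forall>m \<in> stage_nodes Tr t' \<inter> subtree Tr l.
        \<forall>n \<in> stage_nodes Tr t' \<inter> subtree Tr l. \<forall>i.
          x m $ i \<ge> x n $ i - x_ub Dt $ i * real_of_int (r i t' - r i t) \<and>
          x m $ i \<le> x n $ i + x_ub Dt $ i * real_of_int (r i t' - r i t)))"

definition revision_constraints ::
  "'v tree \<Rightarrow> nat \<Rightarrow> ('i \<Rightarrow> nat \<Rightarrow> int) \<Rightarrow> bool" where
  "revision_constraints Tr \<mu> r \<longleftrightarrow>
     (\<forall>i.
        (\<forall>t\<in>{1..<horizon Tr}. r i t \<le> r i (t + 1)) \<and>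
        r i (horizon Tr) \<le> int \<mu> \<and>
        (\<forall>t\<in>{1..<horizon Tr}. r i (t + 1) - r i t \<le> 1) \<and>
        r i 1 = 0 \<and>
        (\<forall>t\<in>stages Tr. 0 \<le> r i t))"

text \<open>The lower end of the stage window is computed over the integers, where subtraction does not
  truncate.\<close>

definition stage_window :: "'v tree \<Rightarrow> nat \<Rightarrow> nat \<Rightarrow> int set" where
  "stage_window Tr \<mu> t = {max (int t - (int (horizon Tr) - int \<mu>) + 1) 0 .. int t - 1}"

definition reduced_nonanticipativity ::
  "'v tree \<Rightarrow> ('v, 'i::finite, 'j::finite, 'k::finite) msp_data \<Rightarrow> nat \<Rightarrow>
     ('v \<Rightarrow> real ^ 'i) \<Rightarrow> ('i \<Rightarrow> nat \<Rightarrow> int) \<Rightarrow> bool" where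
  "reduced_nonanticipativity Tr Dt \<mu> x r \<longleftrightarrow>
     (\<forall>t\<in>stages Tr. \<forall>i. \<forall>n n'.
        reduced_pair Tr t n n' \<and>
        int (stage Tr (last_common_ancestor Tr n n')) \<in> stage_window Tr \<mu> t \<longrightarrow>
          x n $ i \<ge> x n' $ i
            - x_ub Dt $ i * real_of_int (r i t - r i (stage Tr (last_common_ancestor Tr n n'))))"

record ('x, 'y, 'r) formulation =
  obj :: "'x \<Rightarrow> 'y \<Rightarrow> real"
  feasible :: "('x \<times> 'y \<times> 'r) set"

definition AMS ::
  "'v tree \<Rightarrow> ('v, 'i::finite, 'j::finite, 'k::finite) msp_data \<Rightarrow> nat \<Rightarrow>
     ('v \<Rightarrow> real ^ 'i, 'v \<Rightarrow> real ^ 'j, 'i \<Rightarrow> nat \<Rightarrow> int) formulation" where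
  "AMS Tr Dt \<mu> =
     \<lparr> obj = objective Tr Dt,
       feasible = {(x, y, r). linear_constraints Tr Dt x y \<and> local_constraints Tr Dt x y \<and>
                     nonanticipativity Tr Dt x r \<and> revision_constraints Tr \<mu> r} \<rparr>"

definition AMS_plus ::
  "'v tree \<Rightarrow> ('v, 'i::finite, 'j::finite, 'k::finite) msp_data \<Rightarrow> nat \<Rightarrow>
     ('v \<Rightarrow> real ^ 'i, 'v \<Rightarrow> real ^ 'j, 'i \<Rightarrow> nat \<Rightarrow> int) formulation" where
  "AMS_plus Tr Dt \<mu> =
     \<lparr> obj = objective Tr Dt,
       feasible = {(x, y, r). linear_constraints Tr Dt x y \<and> local_constraints Tr Dt x y \<and>
                     reduced_nonanticipativity Tr Dt \<mu> x r \<and> revision_constraints Tr \<mu> r} \<rparr>"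

definition equivalent :: "('x, 'y, 'r) formulation \<Rightarrow> ('x, 'y, 'r) formulation \<Rightarrow> bool" where
  "equivalent F G \<longleftrightarrow> obj F = obj G \<and>
     (\<forall>x y. (\<exists>r. (x, y, r) \<in> feasible F) \<longleftrightarrow> (\<exists>r. (x, y, r) \<in> feasible G))"

text \<open>The value is \<open>\<infinity>\<close> for an infeasible and \<open>-\<infinity>\<close> for an unbounded problem.\<close>

definition optimal_value :: "('x, 'y, 'r) formulation \<Rightarrow> ereal" where
  "optimal_value F = (INF (x, y, r) \<in> feasible F. ereal (obj F x y))"

end

theory Submission
  imports Defs
begin

text \<open>A revision schedule may be enlarged to one that uses all \<open>\<mu>\<close> revisions, which only relaxes the
  constraints. Such a schedule omits a revision in exactly \<open>T - 1 - \<mu>\<close> steps, so any \<open>T - \<mu>\<close>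
  consecutive steps contain a revision and the reduced constraints outside the stage window follow
  from the bounds on the states. Hence all reduced pairs may be used. If there is no revision
  between stage \<open>stage l\<close> and stage \<open>t\<close>, then by induction the states of stage \<open>t\<close> are constant
  below each child of \<open>l\<close>, and the reduced pairs with last common ancestor \<open>l\<close> give a cyclic chain
  of inequalities between these constants, which are therefore equal. If there is a revision, the
  bounds on the states suffice.\<close>

section \<open>Paths and subtrees\<close>

context scenario_tree
begin

lemma stage_pos: "n \<in> nodes Tr \<Longrightarrow> 1 \<le> stage Tr n"
  using stage_root stage_parent by (cases "n = root Tr") auto

lemma path_to_root: "path_to Tr (root Tr) = {root Tr}"
  unfolding path_to_def using stage_root by auto

text \<open>Exponent 0 contributes \<open>n\<close> and every other exponent shifts down by one; the
  bound \<open>k < stage Tr n\<close> shifts along, since the parent has stage one less. This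
  recursion drives the inductions on paths.\<close>

lemma path_to_parent:
  assumes "n \<in> nodes Tr" "n \<noteq> root Tr"
  shows "path_to Tr n = insert n (path_to Tr (parent Tr n))" (is "?L = ?R")
proof
  have s: "stage Tr n = Suc (stage Tr (parent Tr n))"
    using assms stage_parent by blast
  show "?L \<subseteq> ?R"
  proof
    fix a assume "a \<in> ?L"
    then obtain k where k: "a = (parent Tr ^^ k) n" "k < stage Tr n"
      unfolding path_to_def by blast
    show "a \<in> ?R"
    proof (cases k)
      case 0
      then show ?thesis using k by simp
    next
      case (Suc k')
      then have "a = (parent Tr ^^ k') (parent Tr n)" "k' < stage Tr (parent Tr n)"
        using k s by (simp_all add: funpow_swap1)
      then show ?thesis unfolding path_to_def by blast
    qed
  qed
  show "?R \<subseteq> ?L"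
  proof
    fix a assume "a \<in> ?R"
    then consider "a = n" | "a \<in> path_to Tr (parent Tr n)" by blast
    then show "a \<in> ?L"
    proof cases
      case 1
      then have "a = (parent Tr ^^ 0) n" "0 < stage Tr n" using s by simp_all
      then show ?thesis unfolding path_to_def by blast
    next
      case 2
      then obtain k where "a = (parent Tr ^^ k) (parent Tr n)" "k < stage Tr (parent Tr n)"
        unfolding path_to_def by blast
      then have "a = (parent Tr ^^ Suc k) n" "Suc k < stage Tr n"
        using s by (simp_all add: funpow_swap1)
      then show ?thesis unfolding path_to_def by blast
    qed
  qed
qed

text \<open>Passing to the parent lowers the stage, so strong induction on the stage
  applies.\<close>

lemma node_induct [consumes 1, case_names root step]:
  assumes "n \<in> nodes Tr"
    and "P (root Tr)"
    and "\<And>n. n \<in> nodes Tr \<Longrightarrow> n \<noteq> root Tr \<Longrightarrow> P (parent Tr n) \<Longrightarrow> P n"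
  shows "P n"
  using assms(1)
proof (induction "stage Tr n" arbitrary: n rule: less_induct)
  case less
  show ?case
  proof (cases "n = root Tr")
    case False
    then have "P (parent Tr n)"
      using less stage_parent[of n] parent_node[of n] by auto
    then show ?thesis using assms(3) less.prems False by blast
  qed (use assms(2) in simp)
qed

lemma self_in_path: "n \<in> nodes Tr \<Longrightarrow> n \<in> path_to Tr n"
  using path_to_root path_to_parent by (cases "n = root Tr") auto

lemma root_in_path: "n \<in> nodes Tr \<Longrightarrow> root Tr \<in> path_to Tr n"
  by (induction n rule: node_induct) (simp_all add: path_to_root path_to_parent)

lemma path_node: "n \<in> nodes Tr \<Longrightarrow> m \<in> path_to Tr n \<Longrightarrow> m \<in> nodes Tr"
  by (induction n rule: node_induct) (auto simp: path_to_root path_to_parent root_node)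

lemma path_stage_le: "n \<in> nodes Tr \<Longrightarrow> m \<in> path_to Tr n \<Longrightarrow> stage Tr m \<le> stage Tr n"
  by (induction n rule: node_induct) (auto simp: path_to_root path_to_parent stage_parent)

lemma path_trans:
  "n \<in> nodes Tr \<Longrightarrow> m \<in> path_to Tr n \<Longrightarrow> a \<in> path_to Tr m \<Longrightarrow> a \<in> path_to Tr n"
  by (induction n rule: node_induct) (auto simp: path_to_root path_to_parent)

lemma path_stage_eq:
  assumes "n \<in> nodes Tr" "m \<in> path_to Tr n" "stage Tr m = stage Tr n"
  shows "m = n"
proof (cases "n = root Tr")
  case True
  then show ?thesis using assms path_to_root by simp
next
  case False
  then show ?thesis
    using assms path_to_parent[of n] path_stage_le[of "parent Tr n" m] parent_node[of n]
      stage_parent[of n] by auto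
qed

text \<open>The path to a node is a chain ordered by stage: if \<open>b\<close> is not the endpoint
  \<open>n\<close>, its stage is below that of \<open>n\<close>, so \<open>a\<close> is not
  \<open>n\<close> either and both lie on the path to the parent.\<close>

lemma path_chain:
  "n \<in> nodes Tr \<Longrightarrow> a \<in> path_to Tr n \<Longrightarrow> b \<in> path_to Tr n \<Longrightarrow> stage Tr a \<le> stage Tr b
    \<Longrightarrow> a \<in> path_to Tr b"
proof (induction n rule: node_induct)
  case root
  then show ?case by (simp add: path_to_root)
next
  case (step n)
  have pn: "parent Tr n \<in> nodes Tr" using step parent_node by blast
  show ?case
  proof (cases "b = n")
    case False
    then have b: "b \<in> path_to Tr (parent Tr n)" using step path_to_parent by auto
    then have "stage Tr b < stage Tr n"
      using path_stage_le[OF pn] stage_parent[of n] step.hyps by fastforce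
    then have "a \<noteq> n" using step.prems by auto
    then show ?thesis using b step path_to_parent by auto
  qed (use step in simp)
qed

lemma path_unique:
  assumes "n \<in> nodes Tr" "a \<in> path_to Tr n" "b \<in> path_to Tr n" "stage Tr a = stage Tr b"
  shows "a = b"
  using path_chain[OF assms(1-3)] path_stage_eq path_node assms by simp

section \<open>Children and the decomposition of subtrees\<close>

lemma child_node:
  assumes "l \<in> nodes Tr" "stage Tr l < horizon Tr" "j < branching Tr"
  shows "child Tr l j \<in> nodes Tr" "child Tr l j \<noteq> root Tr" "parent Tr (child Tr l j) = l"
  using bij_betwE[OF children[OF assms(1,2)]] assms(3) by auto

lemma child_stage:
  assumes "l \<in> nodes Tr" "stage Tr l < horizon Tr" "j < branching Tr"
  shows "stage Tr (child Tr l j) = Suc (stage Tr l)"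
  using child_node[OF assms] stage_parent by simp

lemma child_inj:
  assumes "l \<in> nodes Tr" "stage Tr l < horizon Tr" "j < branching Tr" "j' < branching Tr"
    "child Tr l j = child Tr l j'"
  shows "j = j'"
  using children[OF assms(1,2)] assms(3-5) unfolding bij_betw_def inj_on_def by auto

lemma subtree_self: "n \<in> nodes Tr \<Longrightarrow> n \<in> subtree Tr n"
  by (simp add: subtree_def self_in_path)

lemma subtree_node: "n \<in> subtree Tr l \<Longrightarrow> n \<in> nodes Tr \<and> l \<in> nodes Tr"
  using path_node by (auto simp: subtree_def)

lemma subtree_stage: "n \<in> subtree Tr l \<Longrightarrow> stage Tr l \<le> stage Tr n"
  using path_stage_le by (auto simp: subtree_def)

lemma subtree_trans: "n \<in> subtree Tr m \<Longrightarrow> m \<in> subtree Tr l \<Longrightarrow> n \<in> subtree Tr l"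
  using path_trans by (auto simp: subtree_def)

lemma child_subtree:
  assumes "l \<in> nodes Tr" "stage Tr l < horizon Tr" "j < branching Tr"
  shows "child Tr l j \<in> subtree Tr l"
  using child_node[OF assms] path_to_parent[of "child Tr l j"] self_in_path assms(1)
  by (simp add: subtree_def)

text \<open>Climbing from \<open>n\<close> towards \<open>l\<close>, the last node met before
  \<open>l\<close> is a child of \<open>l\<close>.\<close>

lemma subtree_child_cases:
  assumes "n \<in> subtree Tr l" "n \<noteq> l"
  shows "\<exists>j<branching Tr. n \<in> subtree Tr (child Tr l j)"
proof -
  have "n \<in> nodes Tr" using assms(1) subtree_node by blast
  then show ?thesis using assms
  proof (induction n rule: node_induct)
    case root
    then show ?case by (simp add: subtree_def path_to_root)
  next
    case (step n)
    have pn: "parent Tr n \<in> nodes Tr" using step parent_node by blast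
    have l: "l \<in> nodes Tr" using step subtree_node by blast
    have "l \<in> path_to Tr (parent Tr n)"
      using step path_to_parent by (auto simp: subtree_def)
    then have p: "parent Tr n \<in> subtree Tr l" using pn by (simp add: subtree_def)
    show ?case
    proof (cases "parent Tr n = l")
      case True
      then have "stage Tr l < horizon Tr"
        using stage_le[OF step.hyps(1)] stage_parent[OF step.hyps(1,2)] by simp
      then have "n \<in> child Tr l ` {..<branching Tr}"
        using bij_betw_imp_surj_on[OF children[OF l]] step.hyps True by auto
      then show ?thesis using subtree_self step.hyps by auto
    next
      case False
      then obtain j where "j < branching Tr" "parent Tr n \<in> subtree Tr (child Tr l j)"
        using step.IH p by blast
      moreover have "n \<in> subtree Tr (parent Tr n)"
        using step.hyps path_to_parent self_in_path[OF pn] by (simp add: subtree_def)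
      ultimately show ?thesis using subtree_trans by blast
    qed
  qed
qed

lemma subtree_children:
  assumes "l \<in> nodes Tr" "stage Tr l < horizon Tr"
  shows "subtree Tr l = insert l (\<Union>j<branching Tr. subtree Tr (child Tr l j))"
  using subtree_child_cases subtree_self[OF assms(1)] subtree_trans child_subtree[OF assms]
  by blast

text \<open>Siblings have the same stage, and a path contains at most one node of each
  stage.\<close>

lemma subtree_children_disjoint:
  assumes "l \<in> nodes Tr" "stage Tr l < horizon Tr" "j < branching Tr" "j' < branching Tr"
    "n \<in> subtree Tr (child Tr l j)" "n \<in> subtree Tr (child Tr l j')"
  shows "j = j'"
proof -
  have "child Tr l j = child Tr l j'"
    using path_unique[of n] assms(5,6) child_stage[OF assms(1,2)] assms(3,4)
    by (simp add: subtree_def)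
  then show ?thesis using child_inj assms by blast
qed

lemma subtree_leaf:
  assumes "l \<in> nodes Tr" "stage Tr l = horizon Tr"
  shows "subtree Tr l = {l}"
  using path_stage_eq subtree_stage subtree_self[OF assms(1)] stage_le assms
  by (fastforce simp: subtree_def)

section \<open>Last common ancestors\<close>

lemma last_common_ancestor_max:
  assumes "m \<in> nodes Tr" "n \<in> nodes Tr"
  shows "last_common_ancestor Tr m n \<in> path_to Tr m \<inter> path_to Tr n"
    and "k \<in> path_to Tr m \<inter> path_to Tr n \<Longrightarrow> stage Tr k \<le> stage Tr (last_common_ancestor Tr m n)"
proof -
  have *: "root Tr \<in> path_to Tr m \<inter> path_to Tr n"
    using root_in_path assms by blast
  \<comment> \<open>The strict bound on the stages ensures that \<open>arg_max\<close> is attained;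
    the root shows that there is a candidate.\<close>
  have **: "\<forall>k. k \<in> path_to Tr m \<inter> path_to Tr n \<longrightarrow> stage Tr k < Suc (stage Tr m)"
    using path_stage_le assms by fastforce
  show "last_common_ancestor Tr m n \<in> path_to Tr m \<inter> path_to Tr n"
    unfolding last_common_ancestor_def by (rule arg_max_natI[where P="\<lambda>k. k \<in> path_to Tr m \<inter> path_to Tr n", OF * **])
  show "k \<in> path_to Tr m \<inter> path_to Tr n \<Longrightarrow> stage Tr k \<le> stage Tr (last_common_ancestor Tr m n)"
    unfolding last_common_ancestor_def by (rule arg_max_nat_le[where P="\<lambda>k. k \<in> path_to Tr m \<inter> path_to Tr n", OF _ **])
qed

text \<open>The ancestor lies in the subtree of \<open>l\<close>, because \<open>l\<close> is itself
  common. If it differed from \<open>l\<close>, it would lie below one child of \<open>l\<close>,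
  and that child would have both \<open>m\<close> and \<open>n\<close> below it.\<close>

lemma last_common_ancestor_children:
  assumes l: "l \<in> nodes Tr" "stage Tr l < horizon Tr" and j: "j < branching Tr" "j' < branching Tr"
    and "j \<noteq> j'" and m: "m \<in> subtree Tr (child Tr l j)" and n: "n \<in> subtree Tr (child Tr l j')"
  shows "last_common_ancestor Tr m n = l"
proof -
  let ?k = "last_common_ancestor Tr m n"
  have nodes: "m \<in> nodes Tr" "n \<in> nodes Tr" using m n subtree_node by blast+
  have k: "?k \<in> path_to Tr m" "?k \<in> path_to Tr n"
    using last_common_ancestor_max(1)[OF nodes] by auto
  have sub: "m \<in> subtree Tr ?k" "n \<in> subtree Tr ?k"
    using k nodes by (simp_all add: subtree_def)
  have lm: "l \<in> path_to Tr m" "l \<in> path_to Tr n"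
    using subtree_trans[OF m child_subtree[OF l j(1)]] subtree_trans[OF n child_subtree[OF l j(2)]]
    by (simp_all add: subtree_def)
  then have "stage Tr l \<le> stage Tr ?k"
    using last_common_ancestor_max(2)[OF nodes] by blast
  then have kl: "?k \<in> subtree Tr l"
    using path_chain[OF nodes(1) lm(1) k(1)] path_node[OF nodes(1) k(1)] by (simp add: subtree_def)
  show ?thesis
  proof (rule ccontr)
    assume "?k \<noteq> l"
    then obtain i where i: "i < branching Tr" "?k \<in> subtree Tr (child Tr l i)"
      using subtree_child_cases[OF kl] by blast
    have "i = j" "i = j'"
      using subtree_children_disjoint[OF l i(1)] j m n sub subtree_trans i(2) by blast+
    then show False using \<open>j \<noteq> j'\<close> by simp
  qed
qed

section \<open>Blocks\<close>

text \<open>Writing the height as \<open>horizon Tr - stage Tr l\<close> makes the listing depend on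
  the node alone, so the recursion runs along the tree.\<close>

lemma dfs_children:
  assumes "stage Tr l < horizon Tr" "l \<in> nodes Tr"
  shows "dfs Tr (horizon Tr - stage Tr l) l =
    l # concat (map (\<lambda>j. dfs Tr (horizon Tr - stage Tr (child Tr l j)) (child Tr l j))
      [0..<branching Tr])"
proof -
  have "horizon Tr - stage Tr l = Suc (horizon Tr - Suc (stage Tr l))" using assms by simp
  then show ?thesis using child_stage[OF assms(2,1)]
    by (auto intro!: arg_cong[of _ _ concat])
qed

text \<open>Induction on the number of levels left below \<open>l\<close>, matching the recursion of
  \<open>dfs\<close>: the claim is passed from all children to their parent.\<close>

lemma top_down_induct [consumes 1, case_names leaf step]:
  assumes "l \<in> nodes Tr"
    and "\<And>l. l \<in> nodes Tr \<Longrightarrow> stage Tr l = horizon Tr \<Longrightarrow> P l"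
    and "\<And>l. l \<in> nodes Tr \<Longrightarrow> stage Tr l < horizon Tr \<Longrightarrow>
      (\<And>j. j < branching Tr \<Longrightarrow> P (child Tr l j)) \<Longrightarrow> P l"
  shows "P l"
  using assms(1)
proof (induction "horizon Tr - stage Tr l" arbitrary: l rule: less_induct)
  case less
  show ?case
  proof (cases "stage Tr l = horizon Tr")
    case False
    then have s: "stage Tr l < horizon Tr" using stage_le less.prems le_neq_implies_less by blast
    have "P (child Tr l j)" if "j < branching Tr" for j
      using less.hyps child_node[OF less.prems s that] child_stage[OF less.prems s that] s by simp
    then show ?thesis using assms(3) less.prems s by blast
  qed (use less assms(2) in simp)
qed

lemma set_dfs: "l \<in> nodes Tr \<Longrightarrow> set (dfs Tr (horizon Tr - stage Tr l) l) = subtree Tr l"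
proof (induction l rule: top_down_induct)
  case (leaf l)
  then show ?case using subtree_leaf by simp
next
  case (step l)
  then show ?case unfolding subtree_children[OF step.hyps] dfs_children[OF step.hyps(2,1)] by auto
qed

text \<open>Only the child whose subtree contains \<open>l\<close> contributes to the filtered
  listing, so the descendants of \<open>l\<close> keep their own depth-first order. This turns the
  globally defined \<open>block\<close> into a recursive object.\<close>

lemma filter_subtree_dfs:
  "n \<in> nodes Tr \<Longrightarrow> l \<in> subtree Tr n \<Longrightarrow>
    filter (\<lambda>m. m \<in> subtree Tr l) (dfs Tr (horizon Tr - stage Tr n) n)
      = dfs Tr (horizon Tr - stage Tr l) l"
proof (induction n rule: top_down_induct)
  case (leaf n)
  then show ?case using subtree_leaf by auto
next
  case (step n)
  show ?case
  proof (cases "l = n")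
    case True
    then show ?thesis using set_dfs[OF step.hyps(1)] by (simp add: filter_id_conv)
  next
    case False
    let ?d = "\<lambda>j. dfs Tr (horizon Tr - stage Tr (child Tr n j)) (child Tr n j)"
    let ?f = "filter (\<lambda>m. m \<in> subtree Tr l)"
    obtain j where j: "j < branching Tr" "l \<in> subtree Tr (child Tr n j)"
      using subtree_child_cases[OF step.prems False] by blast
    have other: "?f (?d i) = []" if "i < branching Tr" "i \<noteq> j" for i
      using set_dfs[OF child_node(1)[OF step.hyps that(1)]]
        subtree_children_disjoint[OF step.hyps that(1) j(1)] that(2) subtree_trans[OF _ j(2)]
      by (auto simp: filter_empty_conv)
    have split: "[0..<branching Tr] = [0..<j] @ j # [Suc j..<branching Tr]"
      using j(1) upt_add_eq_append[of 0 j "branching Tr - j"] by (simp add: upt_conv_Cons)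
    \<comment> \<open>If \<open>n\<close> and \<open>l\<close> were each below the other, their
      stages would agree and they would coincide.\<close>
    have "n \<notin> subtree Tr l"
      using False step.prems subtree_stage path_stage_eq
      by (metis (no_types, lifting) CollectD le_antisym subtree_def)
    then have "?f (dfs Tr (horizon Tr - stage Tr n) n)
        = concat (map (\<lambda>i. ?f (?d i)) [0..<branching Tr])"
      unfolding dfs_children[OF step.hyps(2,1)] by (simp add: filter_concat comp_def)
    also have "\<dots> = ?f (?d j)"
    proof -
      have e: "concat (map (\<lambda>i. ?f (?d i)) [0..<j]) = []"
        "concat (map (\<lambda>i. ?f (?d i)) [Suc j..<branching Tr]) = []"
        unfolding concat_eq_Nil_conv using other j(1) by auto
      show ?thesis unfolding split map_append list.map concat_append concat.simps e by simp
    qed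
    also have "\<dots> = dfs Tr (horizon Tr - stage Tr l) l"
      using step.IH j by blast
    finally show ?thesis .
  qed
qed

lemma block_eq:
  assumes "l \<in> nodes Tr"
  shows "block Tr t l = filter (\<lambda>n. stage Tr n = t) (dfs Tr (horizon Tr - stage Tr l) l)"
proof -
  have "l \<in> subtree Tr (root Tr)" using assms root_in_path by (simp add: subtree_def)
  then have "filter (\<lambda>m. m \<in> subtree Tr l) (dfs Tr (horizon Tr - 1) (root Tr))
      = dfs Tr (horizon Tr - stage Tr l) l"
    using filter_subtree_dfs[OF root_node] stage_root by simp
  moreover have "block Tr t l = filter (\<lambda>n. stage Tr n = t)
      (filter (\<lambda>m. m \<in> subtree Tr l) (dfs Tr (horizon Tr - 1) (root Tr)))"
    unfolding block_def stage_list_def filter_filter by (rule filter_cong) auto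
  ultimately show ?thesis by simp
qed

lemma set_block: "l \<in> nodes Tr \<Longrightarrow> set (block Tr t l) = stage_nodes Tr t \<inter> subtree Tr l"
  using set_dfs subtree_node by (auto simp: block_eq stage_nodes_def)

lemma block_children:
  assumes "l \<in> nodes Tr" "stage Tr l < t" "t \<le> horizon Tr"
  shows "block Tr t l = concat (map (\<lambda>j. block Tr t (child Tr l j)) [0..<branching Tr])"
proof -
  have s: "stage Tr l < horizon Tr" using assms by simp
  have "block Tr t l = concat (map (\<lambda>j. filter (\<lambda>n. stage Tr n = t)
      (dfs Tr (horizon Tr - stage Tr (child Tr l j)) (child Tr l j))) [0..<branching Tr])"
    unfolding block_eq[OF assms(1)] dfs_children[OF s assms(1)] using assms(2)
    by (simp add: filter_concat comp_def)
  also have "\<dots> = concat (map (\<lambda>j. block Tr t (child Tr l j)) [0..<branching Tr])"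
    using block_eq child_node(1)[OF assms(1) s] by (intro arg_cong[of _ _ concat] map_cong) simp_all
  finally show ?thesis .
qed

text \<open>Every non-leaf node has a child, so one can descend to stage \<open>t\<close>. This
  gives meaning to the \<open>hd\<close> and \<open>last\<close> of the blocks of children.\<close>

lemma block_nonempty:
  "l \<in> nodes Tr \<Longrightarrow> stage Tr l \<le> t \<Longrightarrow> t \<le> horizon Tr \<Longrightarrow> block Tr t l \<noteq> []"
proof (induction l rule: top_down_induct)
  case (leaf l)
  then show ?case by (simp add: block_eq)
next
  case (step l)
  show ?case
  proof (cases "stage Tr l = t")
    case True
    then have "l \<in> set (block Tr t l)"
      using step.hyps subtree_self by (simp add: set_block stage_nodes_def)
    then show ?thesis by auto
  next
    case False
    then have s: "stage Tr l < t" using step.prems by simp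
    have "block Tr t (child Tr l 0) \<noteq> []"
      using step.IH[of 0] step.prems branching_pos s child_stage[OF step.hyps, of 0] by simp
    moreover have "0 \<in> set [0..<branching Tr]" using branching_pos by simp
    ultimately show ?thesis
      using block_children[OF step.hyps(1) s step.prems(2)] by (auto simp: concat_eq_Nil_conv)
  qed
qed

end

section \<open>Cyclic successors in concatenated lists\<close>

lemma cyclic_successor_append:
  assumes "as \<noteq> []" "bs \<noteq> []"
  shows "cyclic_successor (xs @ as @ bs @ ys) (last as) (hd bs)"
proof -
  let ?ns = "xs @ as @ bs @ ys"
  let ?k = "length xs + length as - 1"
  have "0 < length as" "0 < length bs" using assms by simp_all
  then have "?k < length ?ns" "Suc ?k = length xs + length as" "Suc ?k < length ?ns"
    unfolding length_append by linarith+
  then have "?k < length ?ns" "Suc ?k mod length ?ns = length xs + length as"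
    by (simp_all only: mod_less)
  moreover have "?ns ! ?k = last as" "?ns ! (length xs + length as) = hd bs"
    using assms by (cases as rule: rev_cases; cases bs; simp add: nth_append)+
  ultimately show ?thesis unfolding cyclic_successor_def by metis
qed

lemma cyclic_successor_wrap:
  assumes "as \<noteq> []" "bs \<noteq> []"
  shows "cyclic_successor (bs @ ys @ as) (last as) (hd bs)"
proof -
  let ?ns = "bs @ ys @ as"
  have "0 < length ?ns" using assms by simp
  then have "length ?ns - 1 < length ?ns" "Suc (length ?ns - 1) mod length ?ns = 0" by simp_all
  moreover have "?ns ! (length ?ns - 1) = last as"
    using assms last_conv_nth[of ?ns] by simp
  moreover have "?ns ! 0 = hd bs" using assms hd_conv_nth[of ?ns] by simp
  ultimately show ?thesis unfolding cyclic_successor_def by metis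
qed

text \<open>Neighbouring segments meet inside the list, except that the last segment meets the first
  through the wrap-around.\<close>

lemma cyclic_successor_concat:
  assumes "j < B" "2 \<le> B" "\<And>j. j < B \<Longrightarrow> f j \<noteq> []"
  shows "cyclic_successor (concat (map f [0..<B])) (last (f j)) (hd (f (Suc j mod B)))"
proof (cases "Suc j = B")
  case True
  have "[0..<B] = 0 # [1..<j] @ [j]"
    using True assms(2) upt_conv_Cons[of 0 B] by auto
  then show ?thesis
    using cyclic_successor_wrap[of "f j" "f 0" "concat (map f [1..<j])"] assms True by simp
next
  case False
  then have j: "Suc j < B" using assms(1) by simp
  have "[0..<B] = [0..<j] @ [j, Suc j] @ [Suc (Suc j)..<B]"
    using j upt_add_eq_append[of 0 j "B - j"] by (simp add: upt_conv_Cons)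
  then show ?thesis
    using cyclic_successor_append[of "f j" "f (Suc j)" "concat (map f [0..<j])"
        "concat (map f [Suc (Suc j)..<B])"] assms(3) j by simp
qed

text \<open>Going once around gives
  \<open>v 0 \<ge> v 1 \<ge> ... \<ge> v (B - 1) \<ge> v 0\<close>, so antisymmetry forces equality.
  This is why one inequality per reduced pair can replace two-sided constraints.\<close>

lemma cyclic_chain_eq:
  fixes v :: "nat \<Rightarrow> 'a::order"
  assumes "\<And>j. j < B \<Longrightarrow> v (Suc j mod B) \<le> v j" "i < B" "j < B"
  shows "v i = v j"
proof -
  have dec: "v b \<le> v a" if "a \<le> b" "b < B" for a b
    using that
  proof (induction b rule: dec_induct)
    case (step b)
    have "v (Suc b) \<le> v b" using assms(1)[of b] step.prems by simp
    also have "v b \<le> v a" using step by simp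
    finally show ?case .
  qed simp
  have wrap: "v 0 \<le> v (B - 1)" using assms(1)[of "B - 1"] assms(2) by simp
  have eq: "v a = v 0" if "a < B" for a
  proof (rule order_antisym)
    show "v a \<le> v 0" using dec[of 0 a] that by simp
    have "v (B - 1) \<le> v a" using dec[of a "B - 1"] that by simp
    with wrap show "v 0 \<le> v a" by (rule order_trans)
  qed
  show ?thesis by (rule trans[OF eq[OF assms(2)] eq[OF assms(3), symmetric]])
qed

section \<open>Revision schedules\<close>

context scenario_tree
begin

lemma revision_mono:
  assumes "revision_constraints Tr \<mu> r" "1 \<le> s" "s \<le> t" "t \<le> horizon Tr"
  shows "r i s \<le> r i t"
  using assms(3,4)
proof (induction t rule: dec_induct)
  case (step t)
  then have "t \<in> {1..<horizon Tr}" using assms(2) by simp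
  then have "r i t \<le> r i (Suc t)" using assms(1) unfolding revision_constraints_def by simp
  then show ?case using step by simp
qed simp

lemma revision_slow:
  assumes "revision_constraints Tr \<mu> r" "1 \<le> s" "s \<le> t" "t \<le> horizon Tr"
  shows "r i t - r i s \<le> int t - int s"
  using assms(3,4)
proof (induction t rule: dec_induct)
  case (step t)
  then have "t \<in> {1..<horizon Tr}" using assms(2) by simp
  then have "r i (t + 1) - r i t \<le> 1" using assms(1) unfolding revision_constraints_def by blast
  then show ?case using step by simp
qed simp

text \<open>The missing revisions are inserted at the earliest stages without a revision.\<close>

lemma revision_extend:
  assumes r: "revision_constraints Tr \<mu> r" and \<mu>: "\<mu> \<le> horizon Tr - 1"
  obtains r' where "revision_constraints Tr \<mu> r'"
    "\<And>i. r' i (horizon Tr) = int \<mu>"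
    "\<And>i s t. 1 \<le> s \<Longrightarrow> s \<le> t \<Longrightarrow> t \<le> horizon Tr \<Longrightarrow> r i t - r i s \<le> r' i t - r' i s"
proof -
  \<comment> \<open>The deficit at the horizon is added at every stage, capped by
    \<open>t - 1\<close>, the largest number of revisions possible by stage
    \<open>t\<close>.\<close>
  define r' where "r' = (\<lambda>i t. min (int t - 1) (r i t + (int \<mu> - r i (horizon Tr))))"
  have top: "r i (horizon Tr) \<le> int \<mu>" for i using r unfolding revision_constraints_def by blast
  have first: "r i 1 = 0" for i using r unfolding revision_constraints_def by blast
  have rT: "r' i (horizon Tr) = int \<mu>" for i
    using \<mu> horizon_pos unfolding r'_def by auto
  have diff: "r i t - r i s \<le> r' i t - r' i s" if "1 \<le> s" "s \<le> t" "t \<le> horizon Tr" for i s t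
    \<comment> \<open>If the cap is attained at \<open>t\<close>, then \<open>r'\<close> gains at
      least \<open>t - s\<close>, which bounds the gain of \<open>r\<close>; otherwise the full
      deficit is present at \<open>t\<close> and at most that much at \<open>s\<close>.\<close>
    using revision_slow[OF r that, of i] unfolding r'_def by linarith
  have r'1: "r' i 1 = 0" for i using top[of i] first unfolding r'_def by simp
  have "revision_constraints Tr \<mu> r'"
    unfolding revision_constraints_def
  proof (intro allI conjI ballI)
    fix i t
    { assume t: "t \<in> {1..<horizon Tr}"
      then have step: "r i t \<le> r i (t + 1)" "r i (t + 1) - r i t \<le> 1"
        using r unfolding revision_constraints_def by blast+
      then show "r' i t \<le> r' i (t + 1)" "r' i (t + 1) - r' i t \<le> 1"
        unfolding r'_def by linarith+ }
    assume "t \<in> stages Tr"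
    then have "1 \<le> t" "t \<le> horizon Tr" unfolding stages_def by simp_all
    then show "0 \<le> r' i t"
      using diff[of 1 t i] revision_mono[OF r, of 1 t i] r'1 by simp
  qed (simp_all only: rT r'1 order_refl)
  then show thesis using that rT diff by blast
qed

end

section \<open>Equivalence of the non-anticipativity constraints\<close>

context adaptive_msp
begin

text \<open>A reduced constraint is the lower inequality of the full system with \<open>l\<close>
  the last common ancestor of the pair.\<close>

lemma reduced_of_nonanticipativity:
  assumes "nonanticipativity Tr Dt x r"
  shows "reduced_nonanticipativity Tr Dt \<mu> x r"
  unfolding reduced_nonanticipativity_def
proof (intro ballI allI impI, elim conjE)
  fix t i n n'
  let ?l = "last_common_ancestor Tr n n'"
  assume t: "t \<in> stages Tr" and "reduced_pair Tr t n n'"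
  then have nodes: "n \<in> stage_nodes Tr t" "n' \<in> stage_nodes Tr t"
    unfolding reduced_pair_def by blast+
  then have nodes': "n \<in> nodes Tr" "n' \<in> nodes Tr" unfolding stage_nodes_def by simp_all
  then have l: "n \<in> subtree Tr ?l" "n' \<in> subtree Tr ?l"
    using last_common_ancestor_max(1)[OF nodes'] by (simp_all add: subtree_def)
  have ln: "?l \<in> nodes Tr" using l(1) subtree_node by blast
  have "stage Tr ?l \<le> t" using subtree_stage[OF l(1)] nodes unfolding stage_nodes_def by simp
  moreover have "stage Tr ?l \<in> stages Tr"
    using stage_pos[OF ln] stage_le[OF ln] unfolding stages_def by simp
  moreover have "?l \<in> stage_nodes Tr (stage Tr ?l)" using ln unfolding stage_nodes_def by simp
  ultimately show "x n $ i \<ge> x n' $ i - x_ub Dt $ i * real_of_int (r i t - r i (stage Tr ?l))"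
    using assms t nodes l unfolding nonanticipativity_def by blast
qed

text \<open>Reduced pairs joining the blocks of consecutive children of \<open>l\<close> compare the
  constants that the induction provides for these children. The assumption \<open>pairs\<close>
  covers all reduced pairs, since the ancestor may lie at any stage before \<open>t\<close>.\<close>

lemma constant_without_revision:
  assumes r: "revision_constraints Tr \<mu> r"
    and pairs: "\<And>t n n'. t \<in> stages Tr \<Longrightarrow> reduced_pair Tr t n n' \<Longrightarrow>
      x n $ i \<ge> x n' $ i - x_ub Dt $ i * real_of_int (r i t - r i (stage Tr (last_common_ancestor Tr n n')))"
    and t: "t \<in> stages Tr"
  shows "l \<in> nodes Tr \<Longrightarrow> stage Tr l \<le> t \<Longrightarrow> r i t = r i (stage Tr l) \<Longrightarrow>
    \<exists>v. \<forall>n \<in> stage_nodes Tr t \<inter> subtree Tr l. x n $ i = v"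
proof (induction l rule: top_down_induct)
  case (leaf l)
  then have "\<forall>n \<in> stage_nodes Tr t \<inter> subtree Tr l. x n $ i = x l $ i" by (simp add: subtree_leaf)
  then show ?case by blast
next
  case (step l)
  have tT: "t \<le> horizon Tr" using t unfolding stages_def by simp
  show ?case
  proof (cases "stage Tr l = t")
    case True
    then have "n = l" if "n \<in> stage_nodes Tr t \<inter> subtree Tr l" for n
      using that path_stage_eq[of n l] True unfolding stage_nodes_def subtree_def by simp
    then show ?thesis by (intro exI[of _ "x l $ i"]) auto
  next
    case False
    then have lt: "stage Tr l < t" using step.prems by simp
    let ?B = "branching Tr"
    let ?c = "child Tr l"
    let ?b = "\<lambda>j. block Tr t (?c j)"
    have c: "?c j \<in> nodes Tr" "stage Tr (?c j) \<le> t" "r i t = r i (stage Tr (?c j))"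
      if "j < ?B" for j
    proof -
      show node: "?c j \<in> nodes Tr" using child_node step.hyps that by blast
      have stage: "stage Tr (?c j) = Suc (stage Tr l)" using child_stage step.hyps that by blast
      then show le: "stage Tr (?c j) \<le> t" using lt by simp
      \<comment> \<open>Monotonicity squeezes the value at the child between two equal values, so
        the induction hypothesis applies to it.\<close>
      have "r i (stage Tr l) \<le> r i (stage Tr (?c j))" "r i (stage Tr (?c j)) \<le> r i t"
        using revision_mono[OF r] stage_pos[OF step.hyps(1)] stage le tT by simp_all
      then show "r i t = r i (stage Tr (?c j))" using step.prems(2) by simp
    qed
    have "\<exists>v. \<forall>n \<in> stage_nodes Tr t \<inter> subtree Tr (?c j). x n $ i = v" if "j < ?B" for j
      using step.IH c that by blast
    then obtain v where v: "x n $ i = v j" 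
      if "j < ?B" "n \<in> stage_nodes Tr t \<inter> subtree Tr (?c j)" for j n
      by metis
    have nonempty: "?b j \<noteq> []" if "j < ?B" for j
      using block_nonempty c that tT by blast
    have "v (Suc j mod ?B) \<le> v j" if j: "j < ?B" for j
    proof (cases "2 \<le> ?B")
      case True
      let ?j' = "Suc j mod ?B"
      have j': "?j' < ?B" "?j' \<noteq> j"
        using True j by (simp, cases "Suc j = ?B") auto
      \<comment> \<open>The last node below one child and the first node below the cyclically next
        child form a reduced pair with ancestor \<open>l\<close>.\<close>
      let ?n = "last (?b j)"
      let ?n' = "hd (?b ?j')"
      have n: "?n \<in> stage_nodes Tr t \<inter> subtree Tr (?c j)"
        and n': "?n' \<in> stage_nodes Tr t \<inter> subtree Tr (?c ?j')"
        using last_in_set[OF nonempty[OF j]] hd_in_set[OF nonempty[OF j'(1)]]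
        unfolding set_block[OF c(1)[OF j]] set_block[OF c(1)[OF j'(1)]] by blast+
      then have lca: "last_common_ancestor Tr ?n ?n' = l"
        using last_common_ancestor_children[OF step.hyps j j'(1)] j'(2) by auto
      have "?n \<noteq> ?n'"
        using n n' subtree_children_disjoint[OF step.hyps j j'(1)] j'(2) by auto
      moreover have "cyclic_successor (block Tr t l) ?n ?n'"
        using cyclic_successor_concat[OF j True, of ?b] nonempty
          block_children[OF step.hyps(1) lt tT] by simp
      ultimately have "reduced_pair Tr t ?n ?n'"
        using n n' lca unfolding reduced_pair_def by simp
      \<comment> \<open>The slack vanishes because \<open>r\<close> takes the same value at
        \<open>t\<close> and at the stage of \<open>l\<close>.\<close>
      from pairs[OF t this] show ?thesis
        using lca step.prems v[OF j n] v[OF j'(1) n'] by simp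
    next
      case False
      \<comment> \<open>With a single child, the inequality compares \<open>v 0\<close> with
        itself.\<close>
      then show ?thesis using j by (cases "?B = 1") auto
    qed
    then have "v j = v 0" if "j < ?B" for j
      using cyclic_chain_eq[of ?B v j 0] that by simp
    moreover have "\<exists>j<?B. n \<in> stage_nodes Tr t \<inter> subtree Tr (?c j)"
      if "n \<in> stage_nodes Tr t \<inter> subtree Tr l" for n
      using subtree_child_cases[of n l] that lt unfolding stage_nodes_def by auto
    ultimately show ?thesis using v by metis
  qed
qed

text \<open>One revision already makes the left side nonpositive, since \<open>x n $ i\<close> is at
  most the upper bound, while \<open>x m $ i\<close> is nonnegative.\<close>

lemma bounds_imp_relaxed:
  assumes "local_constraints Tr Dt x y" "m \<in> nodes Tr" "n \<in> nodes Tr" "1 \<le> (k::int)"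
  shows "x n $ i - x_ub Dt $ i * real_of_int k \<le> x m $ i"
proof -
  have "0 \<le> x m $ i" "x n $ i \<le> x_ub Dt $ i" "0 \<le> x_ub Dt $ i"
    using assms state_bounds[of m "x m" i] state_bounds[of n "x n" i]
    unfolding local_constraints_def by auto
  moreover have "1 \<le> real_of_int k" using assms(4) by simp
  ultimately show ?thesis using mult_left_mono[of 1 "real_of_int k" "x_ub Dt $ i"] by simp
qed

lemma nonanticipativity_of_reduced:
  assumes loc: "local_constraints Tr Dt x y" and r: "revision_constraints Tr \<mu> r"
    and red: "reduced_nonanticipativity Tr Dt \<mu> x r"
    and top: "\<And>i. r i (horizon Tr) = int \<mu>"
  shows "nonanticipativity Tr Dt x r"
proof -
  \<comment> \<open>First the reduced inequalities are recovered for all reduced pairs, inside and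
    outside the window.\<close>
  have pairs: "x n $ i \<ge> x n' $ i
      - x_ub Dt $ i * real_of_int (r i t - r i (stage Tr (last_common_ancestor Tr n n')))"
    if t: "t \<in> stages Tr" and rp: "reduced_pair Tr t n n'" for i t n n'
  proof -
    let ?l = "last_common_ancestor Tr n n'"
    let ?s = "stage Tr ?l"
    have n: "n \<in> nodes Tr" "n' \<in> nodes Tr" "stage Tr n = t" "stage Tr n' = t" "n \<noteq> n'"
      using rp unfolding reduced_pair_def stage_nodes_def by blast+
    have l: "?l \<in> path_to Tr n" "?l \<in> path_to Tr n'"
      using last_common_ancestor_max(1)[OF n(1,2)] by auto
    have "?l \<in> nodes Tr" using path_node[OF n(1) l(1)] .
    then have s1: "1 \<le> ?s" using stage_pos by blast
    have st: "?s \<le> t" using path_stage_le[OF n(1) l(1)] n by simp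
    have "?s \<noteq> t" using path_stage_eq[OF n(1) l(1)] path_stage_eq[OF n(2) l(2)] n by auto
    have tT: "t \<le> horizon Tr" "1 \<le> t" using t unfolding stages_def by simp_all
    show ?thesis
    proof (cases "int ?s \<in> stage_window Tr \<mu> t")
      case True
      then show ?thesis using red t rp unfolding reduced_nonanticipativity_def by blast
    next
      case False
      \<comment> \<open>Since \<open>?s\<close> is nonnegative and below \<open>t\<close>, it can
        miss the window only below the untruncated lower end.\<close>
      then have far: "int ?s \<le> int t - (int (horizon Tr) - int \<mu>)"
        using st \<open>?s \<noteq> t\<close> unfolding stage_window_def by auto
      \<comment> \<open>Of the \<open>\<mu>\<close> revisions, at most \<open>T - t\<close> come
        after stage \<open>t\<close> and at most \<open>?s - 1\<close> by stage \<open>?s\<close>;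
        with \<open>far\<close>, at least one remains in between.\<close>
      have "r i (horizon Tr) - r i t \<le> int (horizon Tr) - int t"
        using revision_slow[OF r tT(2,1) order_refl] .
      moreover have "r i ?s - r i 1 \<le> int ?s - 1"
        using revision_slow[OF r order_refl s1] st tT by simp
      moreover have "r i 1 = 0" using r unfolding revision_constraints_def by blast
      ultimately have "1 \<le> r i t - r i ?s"
        using far top[of i] by linarith
      then show ?thesis using bounds_imp_relaxed[OF loc n(1,2)] by blast
    qed
  qed
  show ?thesis
    unfolding nonanticipativity_def
  proof (intro ballI impI allI)
    fix t t' l m n i
    assume t: "t \<in> stages Tr" "t' \<in> stages Tr" "t \<le> t'" and l: "l \<in> stage_nodes Tr t"
      and m: "m \<in> stage_nodes Tr t' \<inter> subtree Tr l" and n: "n \<in> stage_nodes Tr t' \<inter> subtree Tr l"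
    have l': "l \<in> nodes Tr" "stage Tr l = t" using l unfolding stage_nodes_def by simp_all
    have mn: "m \<in> nodes Tr" "n \<in> nodes Tr" using m n unfolding stage_nodes_def by simp_all
    have mono: "r i t \<le> r i t'" using revision_mono[OF r] t unfolding stages_def by simp
    show "x m $ i \<ge> x n $ i - x_ub Dt $ i * real_of_int (r i t' - r i t) \<and>
      x m $ i \<le> x n $ i + x_ub Dt $ i * real_of_int (r i t' - r i t)"
    proof (cases "r i t' = r i t")
      case True
      then have "\<exists>v. \<forall>n \<in> stage_nodes Tr t' \<inter> subtree Tr l. x n $ i = v"
        using constant_without_revision[OF r pairs t(2) l'(1)] l'(2) t(3) by simp
      then have "x m $ i = x n $ i" using m n by metis
      then show ?thesis using True by simp
    next
      case False
      then have "1 \<le> r i t' - r i t" using mono by simp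
      then show ?thesis
        using bounds_imp_relaxed[OF loc mn] bounds_imp_relaxed[OF loc mn(2,1)]
        by (metis diff_le_eq)
    qed
  qed
qed

text \<open>The upper bounds are nonnegative, so a larger gain of revisions between two stages only
  increases the slack.\<close>

lemma reduced_nonanticipativity_relax:
  assumes loc: "local_constraints Tr Dt x y" and red: "reduced_nonanticipativity Tr Dt \<mu> x r"
    and diff: "\<And>i s t. 1 \<le> s \<Longrightarrow> s \<le> t \<Longrightarrow> t \<le> horizon Tr \<Longrightarrow> r i t - r i s \<le> r' i t - r' i s"
  shows "reduced_nonanticipativity Tr Dt \<mu> x r'"
  unfolding reduced_nonanticipativity_def
proof (intro ballI allI impI)
  fix t i n n'
  let ?l = "last_common_ancestor Tr n n'"
  let ?s = "stage Tr ?l"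
  assume t: "t \<in> stages Tr"
    and *: "reduced_pair Tr t n n' \<and> int ?s \<in> stage_window Tr \<mu> t"
  have old: "x n $ i \<ge> x n' $ i - x_ub Dt $ i * real_of_int (r i t - r i ?s)"
    using red t * unfolding reduced_nonanticipativity_def by blast
  have n: "n \<in> nodes Tr" "n' \<in> nodes Tr"
    using * unfolding reduced_pair_def stage_nodes_def by blast+
  then have "?l \<in> nodes Tr"
    using last_common_ancestor_max(1)[OF n] path_node[OF n(1)] by blast
  then have "1 \<le> ?s" using stage_pos by blast
  moreover have "?s \<le> t" using * unfolding stage_window_def by auto
  ultimately have "r i t - r i ?s \<le> r' i t - r' i ?s"
    using diff t unfolding stages_def by simp
  moreover have "0 \<le> x_ub Dt $ i"
    using loc n(1) state_bounds[of n "x n" i] unfolding local_constraints_def by auto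
  ultimately have "x_ub Dt $ i * real_of_int (r i t - r i ?s)
      \<le> x_ub Dt $ i * real_of_int (r' i t - r' i ?s)"
    by (intro mult_left_mono) (simp_all only: of_int_le_iff)
  then show "x n $ i \<ge> x n' $ i - x_ub Dt $ i * real_of_int (r' i t - r' i ?s)"
    using old by linarith
qed

lemma equivalent_AMS_plus:
  assumes \<mu>: "\<mu> \<le> horizon Tr - 1"
  shows "equivalent (AMS_plus Tr Dt \<mu>) (AMS Tr Dt \<mu>)"
  unfolding equivalent_def
proof (intro conjI allI iffI)
  show "obj (AMS_plus Tr Dt \<mu>) = obj (AMS Tr Dt \<mu>)" by (simp add: AMS_def AMS_plus_def)
  fix x y
  { assume "\<exists>r. (x, y, r) \<in> feasible (AMS_plus Tr Dt \<mu>)"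
    then obtain r where r: "linear_constraints Tr Dt x y" "local_constraints Tr Dt x y"
      "reduced_nonanticipativity Tr Dt \<mu> x r" "revision_constraints Tr \<mu> r"
      by (auto simp: AMS_plus_def)
    \<comment> \<open>The counting argument needs exactly \<open>\<mu>\<close> revisions at the
      horizon, so the schedule is changed here while \<open>x\<close> and \<open>y\<close> stay
      fixed. The converse direction keeps the schedule.\<close>
    obtain r' where r': "revision_constraints Tr \<mu> r'" "\<And>i. r' i (horizon Tr) = int \<mu>"
      "\<And>i s t. 1 \<le> s \<Longrightarrow> s \<le> t \<Longrightarrow> t \<le> horizon Tr \<Longrightarrow> r i t - r i s \<le> r' i t - r' i s"
      by (rule revision_extend[OF r(4) \<mu>]) blast
    have "nonanticipativity Tr Dt x r'"
      using nonanticipativity_of_reduced[OF r(2) r'(1) _ r'(2)]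
        reduced_nonanticipativity_relax[OF r(2,3) r'(3)] by blast
    then show "\<exists>r. (x, y, r) \<in> feasible (AMS Tr Dt \<mu>)"
      using r r'(1) by (auto simp: AMS_def) }
  assume "\<exists>r. (x, y, r) \<in> feasible (AMS Tr Dt \<mu>)"
  then show "\<exists>r. (x, y, r) \<in> feasible (AMS_plus Tr Dt \<mu>)"
    using reduced_of_nonanticipativity by (auto simp: AMS_def AMS_plus_def)
qed

end

section \<open>Optimal values of equivalent formulations\<close>

lemma equivalent_optimal_value:
  assumes "equivalent F G"
  shows "optimal_value F = optimal_value G"
proof -
  have obj: "obj F = obj G"
    and feas: "\<And>x y. (\<exists>r. (x, y, r) \<in> feasible F) \<longleftrightarrow> (\<exists>r. (x, y, r) \<in> feasible G)"
    using assms unfolding equivalent_def by simp_all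
  \<comment> \<open>The objective ignores \<open>r\<close>, so the attained values depend only on
    the projection of the feasible set to \<open>(x, y)\<close>.\<close>
  have image: "(\<lambda>(x, y, r). ereal (obj H x y)) ` feasible H
      = {ereal (obj H x y) | x y. \<exists>r. (x, y, r) \<in> feasible H}" for H :: "('a, 'b, 'c) formulation"
    by (auto simp: image_iff) force
  show ?thesis unfolding optimal_value_def image by (simp only: feas obj)
qed

theorem theorem1:
  fixes Tr :: "'v tree"
    and Dt :: "('v, 'i::finite, 'j::finite, 'k::finite) msp_data"
    and \<mu> :: nat
  assumes "adaptive_msp Tr Dt"
    and "\<mu> \<in> {0..horizon Tr - 1}"
  shows "equivalent (AMS_plus Tr Dt \<mu>) (AMS Tr Dt \<mu>) \<and>
    optimal_value (AMS_plus Tr Dt \<mu>) = optimal_value (AMS Tr Dt \<mu>)"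
  using adaptive_msp.equivalent_AMS_plus[OF assms(1)] equivalent_optimal_value assms(2) by auto

end
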